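(* Let $\mathcal{X}=\overline{([-x_1,x_2],0)}$ with $x_1,x_2>0$ and $x_1<x_2$. If $\mathcal{Y}=\overline{([-y_1,y_2],0)}$ with $y_1,y_2>0$ satisfies $\dfrac{x_1}{x_2}>\dfrac{y_2}{y_1}$ and $\dfrac{x_1}{x_2}<\dfrac{y_1}{y_2}$, there is a unique pair $(\mathcal{Z},\mathcal{R})$ of non invertible elements $\mathcal{Z}=\overline{([-z_1,z_2],0)}$, $\mathcal{R}=\overline{([-r_1,r_2],0)}$ with $z_1,z_2,r_1,r_2\ge 0$ such that $$\mathcal{Y}=\mathcal{X}\bullet\mathcal{Z}+\mathcal{R},\qquad \mathcal{R}<\mathcal{Y},\qquad l(\mathcal{R})\ \text{minimal}$$ (minimal among all such pairs satisfying $\mathcal{Y}=\mathcal{X}\bullet\mathcal{Z}+\mathcal{R}$ and $\mathcal{R}<\mathcal{Y}$). This pair is given by $$\mathcal{Z}=\overline{\left(\left[-\frac{y_2}{x_1},0\right],0\right)},\qquad \mathcal{R}=\overline{\left(\left[-\frac{x_1y_1-x_2y_2}{x_1},0\right],0\right)}.$$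
   Context: $\mathbb{IR}$ is the set of intervals $[a,b]$ with real $a\le b$, with addition $[a,b]+[c,d]=[a+c,b+d]$; $0$ also denotes $[0,0]$. $\overline{\mathbb{IR}}$ is the quotient of $\mathbb{IR}\times\mathbb{IR}$ by $(x,y)\sim(z,t)\iff x+t=y+z$, the class of $(x,y)$ being $\overline{(x,y)}$, with $\overline{(x,y)}+\overline{(z,t)}=\overline{(x+z,y+t)}$ and $\smallsetminus\overline{(x,y)}=\overline{(y,x)}$ the opposite; every element can be written $\overline{(K,0)}$ or $\overline{(0,K)}$ with $K\in\mathbb{IR}$. $l(\overline{([a,b],0)})=b-a$. $\mathcal{R}<\mathcal{Y}$ means that $\mathcal{Y}\smallsetminus\mathcal{R}:=\mathcal{Y}+(\smallsetminus\mathcal{R})$ equals $\overline{(A,0)}$ for some non-degenerate interval $A$. $\mathcal{A}_4$ is the algebra $\mathbb{R}^4$ with product $x\cdot y=(x_1y_1+x_4y_4,\;x_2y_2+x_3y_3,\;x_3y_2+x_2y_3,\;x_4y_1+x_1y_4)$ and unit $(1,1,0,0)$. For $K=[a,b]\in\mathbb{IR}$, $\varphi(K)=(a,b,0,0)$ if $a,b\ge0$; $(0,b,-a,0)$ if $a\le 0\le b$; $(0,0,-a,-b)$ if $a,b\le 0$. Define $\overline{\varphi}:\overline{\mathbb{IR}}\to\mathcal{A}_4$ by $\overline{\varphi}(\overline{(K,0)})=\varphi(K)$, $\overline{\varphi}(\overline{(0,K)})=-\varphi(K)$; an element of $\overline{\mathbb{IR}}$ is called invertible if its image by $\overline{\varphi}$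 is invertible in $\mathcal{A}_4$ (elements $\overline{([-a,b],0)}$ with $a,b\ge0$ are non invertible). Consider on $\mathcal{A}_4$ the equivalence relation $(x_1,x_2,x_3,x_4)\sim(y_1,y_2,y_3,y_4)\iff x_1-y_1=x_3-y_3$ and $x_2-y_2=x_4-y_4$; the composite of $\overline{\varphi}$ with the projection to the quotient is a bijection, whose inverse is denoted $\psi$. Explicitly, with $u=x_1-x_3$, $v=x_2-x_4$, $\psi$ sends the class of $(x_1,x_2,x_3,x_4)$ to $\overline{([u,v],0)}$ if $u\le v$ and to $\overline{(0,[-u,-v])}$ if $u\ge v$. The product on $\overline{\mathbb{IR}}$ is $\mathcal{X}\bullet\mathcal{X}'=\psi$ of the class of $\overline{\varphi}(\mathcal{X})\cdot\overline{\varphi}(\mathcal{X}')$. *)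

theory Defs
  imports Complex_Main "HOL-Library.Interval"
begin

text \<open>The interval \<open>[a,b]\<close>; only meaningful for \<open>a \<le> b\<close>.\<close>

definition ivl :: "real \<Rightarrow> real \<Rightarrow> real interval" where
  "ivl a b = Interval (a, b)"

lemma lower_ivl [simp]: "a \<le> b \<Longrightarrow> lower (ivl a b) = a"
  and upper_ivl [simp]: "a \<le> b \<Longrightarrow> upper (ivl a b) = b"
  by (simp_all add: ivl_def lower.rep_eq upper.rep_eq Interval_inverse)

lemma ivl_lower_upper [simp]: "ivl (lower K) (upper K) = K"
  by (simp add: interval_eq_iff)

definition diff_rel ::
  "real interval \<times> real interval \<Rightarrow> real interval \<times> real interval \<Rightarrow> bool" where
  "diff_rel = (\<lambda>(x, y) (z, t). x + t = y + z)"

lemma equivp_diff_rel: "equivp diff_rel"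
proof (rule equivpI)
  show "reflp diff_rel"
    by (auto simp: reflp_def diff_rel_def add.commute)
  show "symp diff_rel"
    by (auto simp: symp_def diff_rel_def add.commute)
  show "transp diff_rel"
    by (auto simp: transp_def diff_rel_def interval_eq_iff)
qed

quotient_type ivbar = "real interval \<times> real interval" / diff_rel
  by (rule equivp_diff_rel)

lift_definition cls :: "real interval \<Rightarrow> real interval \<Rightarrow> ivbar" is "\<lambda>x y. (x, y)" .

lemma cls_eq_iff: "cls x y = cls z t \<longleftrightarrow> x + t = y + z"
  by transfer (simp add: diff_rel_def)

lemma cls_exhaust: obtains x y where "X = cls x y"
proof -
  have "\<exists>x y. X = cls x y"
    by transfer (metis equivp_reflp[OF equivp_diff_rel] surj_pair)
  with that show thesis by blast
qed

instantiation ivbar :: ab_group_add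
begin

lift_definition zero_ivbar :: ivbar is "(0, 0)" .

lift_definition plus_ivbar :: "ivbar \<Rightarrow> ivbar \<Rightarrow> ivbar"
  is "\<lambda>(x, y) (z, t). (x + z, y + t)"
  by (auto simp: diff_rel_def interval_eq_iff)

lift_definition uminus_ivbar :: "ivbar \<Rightarrow> ivbar" is "\<lambda>(x, y). (y, x)"
  by (auto simp: diff_rel_def interval_eq_iff)

definition minus_ivbar :: "ivbar \<Rightarrow> ivbar \<Rightarrow> ivbar" where
  "minus_ivbar Y R = Y + (- R)"

instance
proof
  fix a b c :: ivbar
  show "a + b + c = a + (b + c)"
    by transfer (auto simp: diff_rel_def interval_eq_iff)
  show "a + b = b + a"
    by transfer (auto simp: diff_rel_def interval_eq_iff)
  show "0 + a = a"
    by transfer (auto simp: diff_rel_def interval_eq_iff)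
  show "- a + a = 0"
    by transfer (auto simp: diff_rel_def interval_eq_iff)
  show "a - b = a + - b"
    by (rule minus_ivbar_def)
qed

end

lemma cls_plus: "cls x y + cls z t = cls (x + z) (y + t)"
  by transfer (auto simp: diff_rel_def interval_eq_iff)

lemma cls_uminus: "- cls x y = cls y x"
  by transfer (auto simp: diff_rel_def interval_eq_iff)

lemma cls_cases:
  obtains (pos) K where "X = cls K 0"
  | (neg) K where "X = cls 0 K" "lower K < upper K"
proof -
  obtain x y where X: "X = cls x y" by (rule cls_exhaust)
  define u v where "u = lower x - lower y" and "v = upper x - upper y"
  show thesis
  proof (cases "u \<le> v")
    case True
    then have "X = cls (ivl u v) 0"
      by (simp add: X cls_eq_iff interval_eq_iff u_def v_def)
    then show thesis by (rule pos)
  next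
    case False
    then have "X = cls 0 (ivl (- u) (- v))" "lower (ivl (- u) (- v)) < upper (ivl (- u) (- v))"
      by (simp_all add: X cls_eq_iff interval_eq_iff u_def v_def)
    then show thesis by (rule neg)
  qed
qed

text \<open>The length is only specified on the classes of pairs \<open>(K, 0)\<close>, where \<open>K\<close> is determined
  by the class.\<close>

definition len :: "ivbar \<Rightarrow> real" where
  "len X = width (THE K. X = cls K 0)"

lemma the_cls_pos [simp]: "(THE K'. cls K 0 = cls K' 0) = K"
  by (auto simp: cls_eq_iff)

lemma len_cls: "len (cls K 0) = width K"
  by (simp add: len_def)

lemma len_ivl: "a \<le> b \<Longrightarrow> len (cls (ivl a b) 0) = b - a"
  by (simp add: len_cls width_def)

definition ivbar_less :: "ivbar \<Rightarrow> ivbar \<Rightarrow> bool" (infix \<open>\<prec>\<close> 50) where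
  "R \<prec> Y \<longleftrightarrow> (\<exists>A. lower A < upper A \<and> Y - R = cls A 0)"

datatype a4 = A4 (c1: real) (c2: real) (c3: real) (c4: real)

instantiation a4 :: "{real_algebra_1, comm_ring_1}"
begin

definition "0 = A4 0 0 0 0"

definition "1 = A4 1 1 0 0"

definition "x + y = A4 (c1 x + c1 y) (c2 x + c2 y) (c3 x + c3 y) (c4 x + c4 y)"

definition "- x = A4 (- c1 x) (- c2 x) (- c3 x) (- c4 x)"

definition "x - y = A4 (c1 x - c1 y) (c2 x - c2 y) (c3 x - c3 y) (c4 x - c4 y)"

definition "r *\<^sub>R x = A4 (r * c1 x) (r * c2 x) (r * c3 x) (r * c4 x)"

definition "x * y =
  A4 (c1 x * c1 y + c4 x * c4 y) (c2 x * c2 y + c3 x * c3 y)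
     (c3 x * c2 y + c2 x * c3 y) (c4 x * c1 y + c1 x * c4 y)"

instance
  by standard
    (simp_all add: zero_a4_def one_a4_def plus_a4_def uminus_a4_def minus_a4_def
      scaleR_a4_def times_a4_def a4.expand algebra_simps)

end

definition a4_rel :: "a4 \<Rightarrow> a4 \<Rightarrow> bool" where
  "a4_rel x y \<longleftrightarrow> c1 x - c1 y = c3 x - c3 y \<and> c2 x - c2 y = c4 x - c4 y"

lemma equivp_a4_rel: "equivp a4_rel"
  by (rule equivpI) (auto simp: reflp_def symp_def transp_def a4_rel_def)

quotient_type a4_quot = a4 / a4_rel
  by (rule equivp_a4_rel)

lift_definition a4_class :: "a4 \<Rightarrow> a4_quot" is "\<lambda>x. x" .

lemma a4_class_eq_iff: "a4_class x = a4_class y \<longleftrightarrow> a4_rel x y"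
  by transfer simp

lemma a4_class_exhaust: obtains x where "c = a4_class x"
proof -
  have "\<exists>x. c = a4_class x"
    by transfer (metis equivp_reflp[OF equivp_a4_rel])
  with that show thesis by blast
qed

definition phi :: "real interval \<Rightarrow> a4" where
  "phi K = (let a = lower K; b = upper K in
     if 0 \<le> a \<and> 0 \<le> b then A4 a b 0 0
     else if a \<le> 0 \<and> 0 \<le> b then A4 0 b (- a) 0
     else A4 0 0 (- a) (- b))"

lemma phi_cases:
  assumes "a \<le> b"
  shows "0 \<le> a \<Longrightarrow> 0 \<le> b \<Longrightarrow> phi (ivl a b) = A4 a b 0 0"
    and "a \<le> 0 \<Longrightarrow> 0 \<le> b \<Longrightarrow> phi (ivl a b) = A4 0 b (- a) 0"
    and "a \<le> 0 \<Longrightarrow> b \<le> 0 \<Longrightarrow> phi (ivl a b) = A4 0 0 (- a) (- b)"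
  using assms by (auto simp: phi_def)

text \<open>A point interval \<open>[c,c]\<close> gives a class that can be written both as \<open>(K, 0)\<close> and as
  \<open>(0, K)\<close>, and for \<open>c \<noteq> 0\<close> the two clauses for the extended embedding then yield different
  (though equivalent) quadruples. The representation \<open>(K, 0)\<close> takes precedence here.\<close>

definition phibar :: "ivbar \<Rightarrow> a4" where
  "phibar X = (if \<exists>K. X = cls K 0 then phi (THE K. X = cls K 0)
               else - phi (THE K. X = cls 0 K))"

lemma phibar_pos: "phibar (cls K 0) = phi K"
  by (auto simp: phibar_def)

lemma phibar_neg:
  assumes "lower K < upper K"
  shows "phibar (cls 0 K) = - phi K"
proof -
  have "cls 0 K \<noteq> cls K' 0" for K'
  proof
    assume "cls 0 K = cls K' 0"
    then have "lower K + lower K' = 0" "upper K + upper K' = 0"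
      by (simp_all add: cls_eq_iff interval_eq_iff)
    then show False
      using assms lower_le_upper[of K'] by linarith
  qed
  moreover have "(THE K'. cls 0 K = cls 0 K') = K"
    by (auto simp: cls_eq_iff)
  ultimately show ?thesis
    by (simp add: phibar_def)
qed

lemma phibar_neg_class: "a4_class (phibar (cls 0 K)) = a4_class (- phi K)"
proof (cases "lower K < upper K")
  case True
  then show ?thesis by (simp add: phibar_neg)
next
  case False
  then have "lower K = upper K"
    using lower_le_upper[of K] by linarith
  then have "cls 0 K = cls (- K) 0"
    by (simp add: cls_eq_iff interval_eq_iff)
  then show ?thesis
    using \<open>lower K = upper K\<close>
    by (auto simp: phibar_pos a4_class_eq_iff a4_rel_def phi_def uminus_a4_def Let_def)
qed

definition ivbar_invertible :: "ivbar \<Rightarrow> bool" where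
  "ivbar_invertible X \<longleftrightarrow> phibar X dvd 1"

definition psi :: "a4_quot \<Rightarrow> ivbar" where
  "psi = inv (a4_class \<circ> phibar)"

lemma phibar_coords:
  "c1 (phibar (cls x y)) - c3 (phibar (cls x y)) = lower x - lower y"
  "c2 (phibar (cls x y)) - c4 (phibar (cls x y)) = upper x - upper y"
proof -
  have phi: "c1 (phi K) - c3 (phi K) = lower K" "c2 (phi K) - c4 (phi K) = upper K" for K
    using lower_le_upper[of K] by (auto simp: phi_def Let_def)
  have "c1 (phibar (cls x y)) - c3 (phibar (cls x y)) = lower x - lower y \<and>
        c2 (phibar (cls x y)) - c4 (phibar (cls x y)) = upper x - upper y"
  proof (cases "cls x y" rule: cls_cases)
    case (pos K)
    moreover from pos have "lower x = lower y + lower K" "upper x = upper y + upper K"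
      by (simp_all add: cls_eq_iff interval_eq_iff)
    ultimately show ?thesis
      using phi[of K] by (simp add: phibar_pos)
  next
    case (neg K)
    moreover from neg have "lower x + lower K = lower y" "upper x + upper K = upper y"
      by (simp_all add: cls_eq_iff interval_eq_iff)
    ultimately show ?thesis
      using phi[of K] by (auto simp: phibar_neg uminus_a4_def)
  qed
  then show "c1 (phibar (cls x y)) - c3 (phibar (cls x y)) = lower x - lower y"
    "c2 (phibar (cls x y)) - c4 (phibar (cls x y)) = upper x - upper y"
    by blast+
qed

lemma bij_class_phibar: "bij (a4_class \<circ> phibar)"
proof (rule bijI)
  show "inj (a4_class \<circ> phibar)"
  proof (rule injI)
    fix X X' assume eq: "(a4_class \<circ> phibar) X = (a4_class \<circ> phibar) X'"
    obtain x y where X: "X = cls x y" by (rule cls_exhaust)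
    obtain x' y' where X': "X' = cls x' y'" by (rule cls_exhaust)
    show "X = X'"
      using eq phibar_coords[of x y] phibar_coords[of x' y']
      by (simp add: X X' a4_class_eq_iff a4_rel_def cls_eq_iff interval_eq_iff)
  qed
  show "surj (a4_class \<circ> phibar)"
  proof (rule surjI)
    fix c
    obtain q where c: "c = a4_class q" by (rule a4_class_exhaust)
    define u v where "u = c1 q - c3 q" and "v = c2 q - c4 q"
    have "\<exists>X. (a4_class \<circ> phibar) X = c"
    proof (cases "u \<le> v")
      case True
      then have "(a4_class \<circ> phibar) (cls (ivl u v) 0) = c"
        using phibar_coords[of "ivl u v" 0]
        by (simp add: c a4_class_eq_iff a4_rel_def u_def v_def)
      then show ?thesis ..
    next
      case False
      then have "(a4_class \<circ> phibar) (cls 0 (ivl (- u) (- v))) = c"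
        using phibar_coords[of 0 "ivl (- u) (- v)"]
        by (simp add: c a4_class_eq_iff a4_rel_def u_def v_def)
      then show ?thesis ..
    qed
    then show "(a4_class \<circ> phibar) ((\<lambda>c. SOME X. (a4_class \<circ> phibar) X = c) c) = c"
      by (rule someI_ex)
  qed
qed

lemma psi_explicit:
  fixes x1 x2 x3 x4 :: real
  defines "u \<equiv> x1 - x3" and "v \<equiv> x2 - x4"
  shows "u \<le> v \<Longrightarrow> psi (a4_class (A4 x1 x2 x3 x4)) = cls (ivl u v) 0"
    and "v \<le> u \<Longrightarrow> psi (a4_class (A4 x1 x2 x3 x4)) = cls 0 (ivl (- u) (- v))"
proof -
  have psi: "psi (a4_class q) = X" if "a4_class (phibar X) = a4_class q" for X q
    using inv_f_eq[OF bij_is_inj[OF bij_class_phibar], of X "a4_class q"] that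
    by (simp add: psi_def)
  show "psi (a4_class (A4 x1 x2 x3 x4)) = cls (ivl u v) 0" if "u \<le> v"
    by (rule psi) (use that phibar_coords[of "ivl u v" 0] in
      \<open>simp add: a4_class_eq_iff a4_rel_def u_def v_def\<close>)
  show "psi (a4_class (A4 x1 x2 x3 x4)) = cls 0 (ivl (- u) (- v))" if "v \<le> u"
    by (rule psi) (use that phibar_coords[of 0 "ivl (- u) (- v)"] in
      \<open>simp add: a4_class_eq_iff a4_rel_def u_def v_def\<close>)
qed

definition ivbar_times :: "ivbar \<Rightarrow> ivbar \<Rightarrow> ivbar" (infixl \<open>\<bullet>\<close> 70) where
  "X \<bullet> X' = psi (a4_class (phibar X * phibar X'))"

definition div_pair :: "ivbar \<Rightarrow> ivbar \<Rightarrow> ivbar \<times> ivbar \<Rightarrow> bool" where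
  "div_pair X Y = (\<lambda>(Z, R).
     (\<exists>z1 z2 r1 r2. 0 \<le> z1 \<and> 0 \<le> z2 \<and> 0 \<le> r1 \<and> 0 \<le> r2 \<and>
        Z = cls (ivl (- z1) z2) 0 \<and> R = cls (ivl (- r1) r2) 0) \<and>
     \<not> ivbar_invertible Z \<and> \<not> ivbar_invertible R \<and>
     Y = X \<bullet> Z + R \<and> R \<prec> Y)"

end

theory Submission
  imports Defs
begin

text \<open>In coordinates the product of two intervals containing \<open>0\<close> is
  \<open>[-x\<^sub>1,x\<^sub>2] \<bullet> [-z\<^sub>1,z\<^sub>2] = [-(x\<^sub>1z\<^sub>2 + x\<^sub>2z\<^sub>1), x\<^sub>1z\<^sub>1 + x\<^sub>2z\<^sub>2]\<close>, so the remainder has length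
  \<open>y\<^sub>1 + y\<^sub>2 - (x\<^sub>1 + x\<^sub>2)(z\<^sub>1 + z\<^sub>2)\<close> and division amounts to maximising \<open>z\<^sub>1 + z\<^sub>2\<close>. The bound
  \<open>x\<^sub>1(z\<^sub>1 + z\<^sub>2) \<le> x\<^sub>1z\<^sub>1 + x\<^sub>2z\<^sub>2 \<le> y\<^sub>2\<close> is attained only for \<open>z\<^sub>2 = 0\<close> and \<open>z\<^sub>1 = y\<^sub>2/x\<^sub>1\<close>, which is
  admissible because \<open>x\<^sub>2y\<^sub>2 < x\<^sub>1y\<^sub>1\<close>.\<close>

lemma cls_ivl_eq_iff:
  "a \<le> b \<Longrightarrow> c \<le> d \<Longrightarrow> cls (ivl a b) 0 = cls (ivl c d) 0 \<longleftrightarrow> a = c \<and> b = d"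
  by (auto simp: cls_eq_iff interval_eq_iff)

lemma cls_ivl_plus:
  assumes "a \<le> b" "c \<le> d"
  shows "cls (ivl a b) 0 + cls (ivl c d) 0 = cls (ivl (a + c) (b + d)) 0"
  using assms by (simp add: cls_plus cls_eq_iff interval_eq_iff)

text \<open>The difference has endpoints \<open>c - a\<close> and \<open>d - b\<close>, so its
  non-degeneracy compares lengths only, not positions.\<close>

lemma ivbar_less_cls_ivl_iff:
  assumes "a \<le> b" "c \<le> d"
  shows "cls (ivl a b) 0 \<prec> cls (ivl c d) 0 \<longleftrightarrow> b - a < d - c"
proof
  assume "cls (ivl a b) 0 \<prec> cls (ivl c d) 0"
  then obtain A where "lower A < upper A" "c = a + lower A" "d = b + upper A"
    using assms
    by (auto simp: ivbar_less_def minus_ivbar_def cls_uminus cls_plus cls_eq_iff interval_eq_iff)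
  then show "b - a < d - c" by simp
next
  assume "b - a < d - c"
  then have "lower (ivl (c - a) (d - b)) < upper (ivl (c - a) (d - b))"
    and "cls (ivl c d) 0 - cls (ivl a b) 0 = cls (ivl (c - a) (d - b)) 0"
    using assms by (simp_all add: minus_ivbar_def cls_uminus cls_plus cls_eq_iff interval_eq_iff)
  then show "cls (ivl a b) 0 \<prec> cls (ivl c d) 0"
    unfolding ivbar_less_def by blast
qed

lemma phibar_ivl_zero:
  assumes "0 \<le> a" "0 \<le> b"
  shows "phibar (cls (ivl (- a) b) 0) = A4 0 b a 0"
  using phi_cases(2)[of "- a" b] assms by (simp add: phibar_pos)

text \<open>Coordinates 1 and 4 of the image vanish, so every multiple of it has first coordinate 0,
  whereas the unit has 1 there.\<close>

lemma not_invertible_ivl_zero: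
  assumes "0 \<le> a" "0 \<le> b"
  shows "\<not> ivbar_invertible (cls (ivl (- a) b) 0)"
  using assms by (auto simp: ivbar_invertible_def phibar_ivl_zero dvd_def one_a4_def times_a4_def)

text \<open>The product of \<open>A4 0 b a 0\<close> and \<open>A4 0 d c 0\<close> again has outer
  coordinates 0, and \<open>psi\<close> reads the endpoints off the two middle ones.\<close>

lemma times_ivl_zero:
  assumes "0 \<le> a" "0 \<le> b" "0 \<le> c" "0 \<le> d"
  shows "cls (ivl (- a) b) 0 \<bullet> cls (ivl (- c) d) 0 =
    cls (ivl (- (a * d + b * c)) (a * c + b * d)) 0"
proof -
  have "0 \<le> a * d" "0 \<le> b * c" "0 \<le> a * c" "0 \<le> b * d"
    using assms by simp_all
  then have "0 - (a * d + b * c) \<le> b * d + a * c - 0" by linarith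
  then show ?thesis
    using assms psi_explicit(1)[of 0 "a * d + b * c" "b * d + a * c" 0]
    by (simp add: ivbar_times_def phibar_ivl_zero times_a4_def add.commute)
qed

text \<open>Comparing endpoints turns division into two real equations. Their sum is
  \<open>y1 + y2 = r1 + r2 + (x1 + x2) * (z1 + z2)\<close>, so the order condition amounts to
  \<open>0 < z1 + z2\<close>.\<close>

lemma div_pair_ivl_zero_iff:
  assumes "0 \<le> x1" "0 \<le> x2" "0 < x1 + x2" "0 \<le> y1" "0 \<le> y2"
  shows "div_pair (cls (ivl (- x1) x2) 0) (cls (ivl (- y1) y2) 0) (Z, R) \<longleftrightarrow>
    (\<exists>z1 z2 r1 r2. 0 \<le> z1 \<and> 0 \<le> z2 \<and> 0 \<le> r1 \<and> 0 \<le> r2 \<and>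
       Z = cls (ivl (- z1) z2) 0 \<and> R = cls (ivl (- r1) r2) 0 \<and>
       y1 = x1 * z2 + x2 * z1 + r1 \<and> y2 = x1 * z1 + x2 * z2 + r2 \<and> 0 < z1 + z2)"
proof -
  have eq: "cls (ivl (- y1) y2) 0 = cls (ivl (- x1) x2) 0 \<bullet> cls (ivl (- z1) z2) 0
        + cls (ivl (- r1) r2) 0
      \<and> cls (ivl (- r1) r2) 0 \<prec> cls (ivl (- y1) y2) 0 \<longleftrightarrow>
      y1 = x1 * z2 + x2 * z1 + r1 \<and> y2 = x1 * z1 + x2 * z2 + r2 \<and> 0 < z1 + z2"
    if "0 \<le> z1" "0 \<le> z2" "0 \<le> r1" "0 \<le> r2" for z1 z2 r1 r2
  proof -
    have nn: "0 \<le> x1 * z2" "0 \<le> x2 * z1" "0 \<le> x1 * z1" "0 \<le> x2 * z2"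
      using assms that by simp_all
    have "cls (ivl (- x1) x2) 0 \<bullet> cls (ivl (- z1) z2) 0 + cls (ivl (- r1) r2) 0 =
        cls (ivl (- (x1 * z2 + x2 * z1) + - r1) (x1 * z1 + x2 * z2 + r2)) 0"
      unfolding times_ivl_zero[OF assms(1,2) that(1,2)]
      by (rule cls_ivl_plus) (use nn that in linarith)+
    moreover have "cls (ivl (- y1) y2) 0 =
        cls (ivl (- (x1 * z2 + x2 * z1) + - r1) (x1 * z1 + x2 * z2 + r2)) 0 \<longleftrightarrow>
        - y1 = - (x1 * z2 + x2 * z1) + - r1 \<and> y2 = x1 * z1 + x2 * z2 + r2"
      by (rule cls_ivl_eq_iff) (use nn that assms in linarith)+
    moreover have "cls (ivl (- r1) r2) 0 \<prec> cls (ivl (- y1) y2) 0 \<longleftrightarrow> r1 + r2 < y1 + y2"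
      using ivbar_less_cls_ivl_iff[of "- r1" r2 "- y1" y2] that assms by (simp add: algebra_simps)
    moreover have "r1 + r2 < y1 + y2 \<longleftrightarrow> 0 < z1 + z2"
      if "y1 = x1 * z2 + x2 * z1 + r1" "y2 = x1 * z1 + x2 * z2 + r2"
    proof -
      have "y1 + y2 = r1 + r2 + (x1 + x2) * (z1 + z2)"
        unfolding that by algebra
      then show ?thesis
        using \<open>0 < x1 + x2\<close> by (simp add: zero_less_mult_iff)
    qed
    ultimately show ?thesis by auto
  qed
  show ?thesis
    unfolding div_pair_def prod.case using eq not_invertible_ivl_zero by blast
qed

text \<open>A strict minimum at \<open>q\<close> yields existence and uniqueness together.\<close>

lemma is_arg_min_unique_minimum:
  fixes f :: "'a \<Rightarrow> 'b::linorder"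
  assumes "P q" "\<And>p. P p \<Longrightarrow> p \<noteq> q \<Longrightarrow> f q < f p"
  shows "is_arg_min f P p \<longleftrightarrow> p = q"
  using assms by (metis is_arg_min_def not_less_iff_gr_or_eq)

theorem theorem25:
  fixes x1 x2 y1 y2 :: real and X Y :: ivbar
  assumes "0 < x1" and "0 < x2" and "x1 < x2"
    and "X = cls (ivl (- x1) x2) 0"
    and "0 < y1" and "0 < y2"
    and "Y = cls (ivl (- y1) y2) 0"
    and "x1 / x2 > y2 / y1" and "x1 / x2 < y1 / y2"
  shows "(\<exists>!p. is_arg_min (\<lambda>(Z, R). len R) (div_pair X Y) p) \<and>
    is_arg_min (\<lambda>(Z, R). len R) (div_pair X Y)
      (cls (ivl (- (y2 / x1)) 0) 0,
       cls (ivl (- ((x1 * y1 - x2 * y2) / x1)) 0) 0)"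
proof -
  define z r where "z = y2 / x1" and "r = (x1 * y1 - x2 * y2) / x1"
  have z: "0 < z" "x1 * z = y2"
    using assms by (simp_all add: z_def)
  \<comment> \<open>Nonnegativity is the hypothesis \<open>x1 / x2 > y2 / y1\<close> with
    denominators cleared.\<close>
  have r: "0 \<le> r" "y1 = x2 * z + r"
    using assms by (simp_all add: z_def r_def field_simps)
  have iff: "div_pair X Y (Z, R) \<longleftrightarrow>
    (\<exists>z1 z2 r1 r2. 0 \<le> z1 \<and> 0 \<le> z2 \<and> 0 \<le> r1 \<and> 0 \<le> r2 \<and>
       Z = cls (ivl (- z1) z2) 0 \<and> R = cls (ivl (- r1) r2) 0 \<and>
       y1 = x1 * z2 + x2 * z1 + r1 \<and> y2 = x1 * z1 + x2 * z2 + r2 \<and> 0 < z1 + z2)" for Z R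
    using div_pair_ivl_zero_iff[of x1 x2 y1 y2] assms by simp
  let ?q = "(cls (ivl (- z) 0) 0, cls (ivl (- r) 0) 0)"
  have "div_pair X Y ?q"
    unfolding iff
    by (rule exI[of _ z], rule exI[of _ 0], rule exI[of _ r], rule exI[of _ 0]) (use z r in simp)
  moreover have "(case ?q of (Z, R) \<Rightarrow> len R) < (case p of (Z, R) \<Rightarrow> len R)"
    if p: "div_pair X Y p" "p \<noteq> ?q" for p
  proof -
    obtain z1 z2 r1 r2 where nn: "0 \<le> z1" "0 \<le> z2" "0 \<le> r1" "0 \<le> r2"
      and p_eq: "p = (cls (ivl (- z1) z2) 0, cls (ivl (- r1) r2) 0)"
      and y1: "y1 = x1 * z2 + x2 * z1 + r1" and y2: "y2 = x1 * z1 + x2 * z2 + r2"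
      using p(1) iff by (cases p) blast
    \<comment> \<open>The shortfall from the optimal sum \<open>z\<close>; as
      \<open>x1 < x2\<close>, both summands on the right are nonnegative.\<close>
    have gap: "x1 * z - x1 * (z1 + z2) = (x2 - x1) * z2 + r2"
      using y2 z(2) by (simp add: algebra_simps)
    have nonneg: "0 \<le> (x2 - x1) * z2"
      using nn assms by simp
    \<comment> \<open>Without shortfall both summands vanish, which forces
      \<open>z2 = r2 = 0\<close> and hence the pair \<open>?q\<close>.\<close>
    have "z1 + z2 \<noteq> z"
    proof
      assume eq: "z1 + z2 = z"
      then have "(x2 - x1) * z2 + r2 = 0"
        using gap by simp
      then have "(x2 - x1) * z2 = 0" "r2 = 0"
        using nonneg nn by linarith+
      then have "z2 = 0" "z1 = z"
        using eq assms by auto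
      then have "p = ?q"
        using y1 r(2) \<open>r2 = 0\<close> by (simp add: p_eq)
      with p(2) show False ..
    qed
    moreover have "x1 * (z1 + z2) \<le> x1 * z"
      using gap nonneg nn by linarith
    ultimately have "z1 + z2 < z"
      using assms by simp
    \<comment> \<open>A smaller sum absorbs less of the total length \<open>y1 + y2\<close> and
      leaves a longer remainder.\<close>
    then have "(x1 + x2) * (z1 + z2) < (x1 + x2) * z"
      using assms by simp
    moreover have "r1 + r2 = y1 + y2 - (x1 + x2) * (z1 + z2)" "r = y1 + y2 - (x1 + x2) * z"
      using y1 y2 z(2) r(2) by (simp_all add: algebra_simps)
    ultimately have "r < r1 + r2" by linarith
    then show ?thesis
      using nn r by (simp add: p_eq len_ivl)
  qed
  ultimately have "is_arg_min (\<lambda>(Z, R). len R) (div_pair X Y) p \<longleftrightarrow> p = ?q" for p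
    by (rule is_arg_min_unique_minimum)
  then show ?thesis
    unfolding z_def r_def by simp
qed

end
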